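(* Let $\mathcal{S}=\{S_1,\ldots,S_d\}$ be a partition of $\mathbb{N}_n$ into nonempty sets, let $n_j$ be the cardinality of $S_j$, and let $\bm{\psi}_j:\mathbb{R}^{n_j}\to\mathbb{R}$, $j\in\mathbb{N}_d$, be convex functions. Suppose that $\bm{\psi}:\mathbb{R}^n\to[0,+\infty)$ is the $\mathcal{S}$-block separable function $\bm{\psi}(\mathbf{u})=\sum_{j\in\mathbb{N}_d}\bm{\psi}_j(\mathbf{u}_j)$, $\mathbf{u}\in\mathbb{R}^n$. Let $\lambda>0$ and $l\in\{0,1,\ldots,d\}$. Then the regularization problem $$\min\{\bm{\psi}(\mathbf{u})+\lambda\|\mathbf{u}\|_1:\mathbf{u}\in\mathbb{R}^n\}$$ has a solution having $\mathcal{S}$-block sparsity of level $l'$ for some $l'\leq l$ if and only if there exist distinct $k_i\in\mathbb{N}_d$, $i\in\mathbb{N}_l$, such that $$\lambda\geq\min\{\|\mathbf{y}\|_\infty:\mathbf{y}\in\partial\bm{\psi}_j(\mathbf{0})\}\quad\text{for all } j\in\mathbb{N}_d\setminus\{k_i:i\in\mathbb{N}_l\}.\qquad( * )$$ In particular, if all $\bm{\psi}_j$, $j\in\mathbb{N}_d$, are differentiable, then condition $( * )$ is equivalent to $$\lambda\geq\|\nabla\bm{\psi}_j(\mathbf{0})\|_\infty\quad\text{for all } j\in\mathbb{N}_d\setminus\{k_i:i\in\mathbb{N}_l\}.$$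
   Context: $\mathbb{N}_d:=\{1,\ldots,d\}$ and $\mathbb{N}_0:=\emptyset$. For $\mathbf{u}=[u_k:k\in\mathbb{N}_n]\in\mathbb{R}^n$, the sub-vector $\mathbf{u}_j\in\mathbb{R}^{n_j}$ consists of the components $u_k$, $k\in S_j$, listed in increasing order of $k$. A vector $\mathbf{u}\in\mathbb{R}^n$ has $\mathcal{S}$-block sparsity of level $l$ if exactly $l$ of its sub-vectors $\mathbf{u}_1,\ldots,\mathbf{u}_d$ are nonzero. $\partial f(\mathbf{x})$ denotes the subdifferential of a convex function $f$ at $\mathbf{x}$. A solution of a minimization problem is a point at which the minimum is attained. *)

theory Defs
  imports "HOL-Analysis.Analysis" "HOL-Analysis.Finite_Function_Topology"
    "HOL-Library.Disjoint_Sets"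
begin

text \<open>
  The blocks have different dimensions, so these cannot be types. All the spaces \<open>R\<^sup>m\<close> are
  taken inside the real normed space of finitely supported functions \<open>nat \<Rightarrow>\<^sub>0 real\<close>, as the
  coordinate subspaces of vectors vanishing outside \<open>{1..m}\<close>. Functions on \<open>R\<^sup>m\<close> are only
  ever considered on this subspace, and derivatives are taken within it.
\<close>

type_synonym rvec = "nat \<Rightarrow>\<^sub>0 real"

definition Rn :: "nat \<Rightarrow> rvec set" where
  "Rn m = {x. Poly_Mapping.keys x \<subseteq> {1..m}}"

definition dot :: "nat \<Rightarrow> rvec \<Rightarrow> rvec \<Rightarrow> real" where
  "dot m x y = (\<Sum>i=1..m. Poly_Mapping.lookup x i * Poly_Mapping.lookup y i)"

definition norm_one :: "nat \<Rightarrow> rvec \<Rightarrow> real" where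
  "norm_one m x = (\<Sum>i=1..m. \<bar>Poly_Mapping.lookup x i\<bar>)"

text \<open>Meaningful for \<open>m \<ge> 1\<close> only.\<close>

definition norm_sup :: "nat \<Rightarrow> rvec \<Rightarrow> real" where
  "norm_sup m x = (MAX i\<in>{1..m}. \<bar>Poly_Mapping.lookup x i\<bar>)"

text \<open>
  The components \<open>u\<^sub>k\<close>, \<open>k \<in> A\<close>, in increasing order of \<open>k\<close>, as a vector of \<open>R\<^sup>c\<close>
  with \<open>c = card A\<close>. The shift by one is due to list positions starting at \<open>0\<close>.
\<close>

definition subvec :: "nat set \<Rightarrow> rvec \<Rightarrow> rvec" where
  "subvec A u = Abs_poly_mapping (\<lambda>i.
     if i \<in> {1..card A} then Poly_Mapping.lookup u (sorted_list_of_set A ! (i - 1)) else 0)"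

lemma lookup_subvec:
  "Poly_Mapping.lookup (subvec A u) i =
     (if i \<in> {1..card A} then Poly_Mapping.lookup u (sorted_list_of_set A ! (i - 1)) else 0)"
proof -
  have "finite {i. (if i \<in> {1..card A}
      then Poly_Mapping.lookup u (sorted_list_of_set A ! (i - 1)) else 0) \<noteq> 0}"
    by (rule finite_subset[of _ "{1..card A}"]) auto
  then show ?thesis
    unfolding subvec_def by (simp add: Abs_poly_mapping_inverse)
qed

lemma subvec_in_Rn: "subvec A u \<in> Rn (card A)"
  by (auto simp: Rn_def in_keys_iff lookup_subvec split: if_splits)

definition block_sparsity :: "(nat \<Rightarrow> nat set) \<Rightarrow> nat \<Rightarrow> rvec \<Rightarrow> nat" where
  "block_sparsity S d u = card {j \<in> {1..d}. subvec (S j) u \<noteq> 0}"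

definition subdifferential :: "nat \<Rightarrow> (rvec \<Rightarrow> real) \<Rightarrow> rvec \<Rightarrow> rvec set" where
  "subdifferential m f x = {y \<in> Rn m. \<forall>v\<in>Rn m. f v \<ge> f x + dot m y (v - x)}"

definition gradient :: "nat \<Rightarrow> (rvec \<Rightarrow> real) \<Rightarrow> rvec \<Rightarrow> rvec" where
  "gradient m f x = (THE g. g \<in> Rn m \<and> (f has_derivative dot m g) (at x within Rn m))"

end

theory Submission
  imports Defs
begin

text \<open>
  The regularized objective splits over the blocks, so a vector is a minimizer iff each of its
  blocks minimizes \<open>\<psi>\<^sub>j + \<lambda>\<parallel>\<cdot>\<parallel>\<^sub>1\<close>, and everything reduces to two facts about a convex function
  \<open>f\<close> on \<open>R\<^sup>m\<close>. First, \<open>0\<close> minimizes \<open>f + \<lambda>\<parallel>\<cdot>\<parallel>\<^sub>1\<close> iff some subgradient of \<open>f\<close> at \<open>0\<close> has sup norm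
  at most \<open>\<lambda>\<close>: the subgradient is built one coordinate at a time, replacing each penalty
  \<open>\<lambda>\<bar>v\<^sub>i\<bar>\<close> by a linear term \<open>- c\<^sub>i v\<^sub>i\<close> with \<open>\<bar>c\<^sub>i\<bar> \<le> \<lambda>\<close> as in the Hahn--Banach theorem.
  Second, if \<open>f\<close> is bounded below, then \<open>f + \<lambda>\<parallel>\<cdot>\<parallel>\<^sub>1\<close> attains its minimum, since subgradients exist
  everywhere and make \<open>f\<close> lower semicontinuous.
\<close>

subsection \<open>Trading absolute values for linear terms\<close>

lemma convex_on_minus_linear:
  fixes \<phi> :: "'a::real_vector \<Rightarrow> real"
  assumes "convex_on V H" and "linear \<phi>"
  shows "convex_on V (\<lambda>v. H v - c * \<phi> v)"
  unfolding convex_on_def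
proof (intro conjI ballI allI impI)
  show "convex V" using assms(1) by (simp add: convex_on_def)
  fix x y and u v :: real
  assume h: "x \<in> V" "y \<in> V" "u \<ge> 0" "v \<ge> 0" "u + v = 1"
  then have "H (u *\<^sub>R x + v *\<^sub>R y) \<le> u * H x + v * H y"
    using assms(1) by (simp add: convex_on_def)
  moreover have "\<phi> (u *\<^sub>R x + v *\<^sub>R y) = u * \<phi> x + v * \<phi> y"
    using assms(2) by (simp add: linear_add linear_cmul)
  ultimately show "H (u *\<^sub>R x + v *\<^sub>R y) - c * \<phi> (u *\<^sub>R x + v *\<^sub>R y)
      \<le> u * (H x - c * \<phi> x) + v * (H y - c * \<phi> y)"
    by (simp add: algebra_simps)
qed

lemma convex_on_plus_abs_linear:
  fixes \<phi> :: "'a::real_vector \<Rightarrow> real"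
  assumes "convex_on V H" and "linear \<phi>" and "lam \<ge> 0"
  shows "convex_on V (\<lambda>v. H v + lam * \<bar>\<phi> v\<bar>)"
  unfolding convex_on_def
proof (intro conjI ballI allI impI)
  show "convex V" using assms(1) by (simp add: convex_on_def)
  fix x y and u v :: real
  assume h: "x \<in> V" "y \<in> V" "u \<ge> 0" "v \<ge> 0" "u + v = 1"
  have *: "H (u *\<^sub>R x + v *\<^sub>R y) \<le> u * H x + v * H y"
    using assms(1) h by (simp add: convex_on_def)
  have "\<phi> (u *\<^sub>R x + v *\<^sub>R y) = u * \<phi> x + v * \<phi> y"
    using assms(2) by (simp add: linear_add linear_cmul)
  then have "\<bar>\<phi> (u *\<^sub>R x + v *\<^sub>R y)\<bar> \<le> u * \<bar>\<phi> x\<bar> + v * \<bar>\<phi> y\<bar>"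
    using h abs_triangle_ineq[of "u * \<phi> x" "v * \<phi> y"] by (simp add: abs_mult)
  then have "lam * \<bar>\<phi> (u *\<^sub>R x + v *\<^sub>R y)\<bar> \<le> lam * (u * \<bar>\<phi> x\<bar> + v * \<bar>\<phi> y\<bar>)"
    using assms(3) by (rule mult_left_mono)
  then show "H (u *\<^sub>R x + v *\<^sub>R y) + lam * \<bar>\<phi> (u *\<^sub>R x + v *\<^sub>R y)\<bar>
      \<le> u * (H x + lam * \<bar>\<phi> x\<bar>) + v * (H y + lam * \<bar>\<phi> y\<bar>)"
    using * by (simp add: algebra_simps)
qed

text \<open>The slope \<open>c\<close> has to lie below every quotient
  \<open>(H v - a) / \<phi> v\<close> with \<open>\<phi> v > 0\<close> and above every one with
  \<open>\<phi> v < 0\<close>. Two points on opposite sides have a convex combination where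
  \<open>\<phi>\<close>, and so the penalty, vanishes; \<open>bound\<close> and convexity of
  \<open>H\<close> there put the quotients in the right order. This is the one-dimensional step of a
  Hahn-Banach argument.\<close>

lemma abs_penalty_slope:
  fixes \<phi> :: "'a::real_vector \<Rightarrow> real"
  assumes H: "convex_on V H" and \<phi>: "linear \<phi>" and lam: "lam \<ge> 0"
    and bound: "\<And>v. v \<in> V \<Longrightarrow> a \<le> H v + lam * \<bar>\<phi> v\<bar>"
  shows "\<exists>c. \<bar>c\<bar> \<le> lam \<and> (\<forall>v\<in>V. a \<le> H v - c * \<phi> v)"
proof -
  \<comment> \<open>The element \<open>lam\<close> keeps \<open>Q\<close> nonempty when
    \<open>\<phi>\<close> is nowhere positive on \<open>V\<close>, and yields
    \<open>c \<le> lam\<close>. The other half of \<open>\<bar>c\<bar> \<le> lam\<close> comes from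
    the lower bound \<open>- lam\<close> of \<open>Q\<close>.\<close>
  define Q where "Q = insert lam {(H v - a) / \<phi> v |v. v \<in> V \<and> \<phi> v > 0}"
  define c where "c = Inf Q"
  have lower: "- lam \<le> q" if q: "q \<in> Q" for q
  proof (cases "q = lam")
    case False
    then obtain v where v: "v \<in> V" "\<phi> v > 0" "q = (H v - a) / \<phi> v"
      using q by (auto simp: Q_def)
    then show ?thesis
      using bound[of v] by (simp add: pos_le_divide_eq)
  qed (use lam in simp)
  have bdd: "bdd_below Q" using lower by (rule bdd_belowI)
  have le: "c \<le> q" if "q \<in> Q" for q
    unfolding c_def using that bdd by (rule cInf_lower)
  have ge: "b \<le> c" if "\<And>q. q \<in> Q \<Longrightarrow> b \<le> q" for b
    unfolding c_def by (rule cInf_greatest) (auto simp: Q_def that)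
  have "a \<le> H v - c * \<phi> v" if v: "v \<in> V" for v
  proof -
    consider "\<phi> v > 0" | "\<phi> v = 0" | "\<phi> v < 0" by linarith
    then show ?thesis
    proof cases
      case 1
      then have "(H v - a) / \<phi> v \<in> Q" using v by (auto simp: Q_def)
      then have "c \<le> (H v - a) / \<phi> v" by (rule le)
      then show ?thesis using 1 by (simp add: pos_le_divide_eq)
    next
      case 2
      then show ?thesis using bound[OF v] by simp
    next
      case 3
      have "(H v - a) / \<phi> v \<le> q" if q: "q \<in> Q" for q
      proof (cases "q = lam")
        case True
        then show ?thesis using bound[OF v] 3 by (simp add: neg_divide_le_eq)
      next
        case False
        then obtain w where w: "w \<in> V" "\<phi> w > 0" "q = (H w - a) / \<phi> w"
          using q by (auto simp: Q_def)
        \<comment> \<open>These are the convex weights for which \<open>\<phi>\<close> vanishes at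
          the combination of \<open>v\<close> and \<open>w\<close>.\<close>
        define s t where "s = \<phi> w / (\<phi> w - \<phi> v)" and "t = - \<phi> v / (\<phi> w - \<phi> v)"
        have st: "s \<ge> 0" "t \<ge> 0" "s + t = 1"
          using 3 w by (auto simp: s_def t_def divide_nonneg_nonneg divide_nonpos_pos simp flip: diff_divide_distrib)
        have p: "s *\<^sub>R v + t *\<^sub>R w \<in> V"
          using H v w st by (simp add: convex_on_def convexD)
        have "\<phi> (s *\<^sub>R v + t *\<^sub>R w) = 0"
          using \<phi> by (simp add: linear_add linear_diff linear_cmul s_def t_def)
        then have "a \<le> H (s *\<^sub>R v + t *\<^sub>R w)"
          using bound[OF p] by simp
        also have "\<dots> \<le> s * H v + t * H w"
          using H v w st by (simp add: convex_on_def)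
        also have "\<dots> = (\<phi> w * H v - \<phi> v * H w) / (\<phi> w - \<phi> v)"
          by (simp add: s_def t_def diff_divide_distrib)
        finally have "a * (\<phi> w - \<phi> v) \<le> \<phi> w * H v - \<phi> v * H w"
          using 3 w by (simp add: pos_le_divide_eq)
        then have "(H w - a) * \<phi> v \<le> (H v - a) * \<phi> w"
          by (simp add: algebra_simps)
        then show ?thesis
          using 3 w by (simp add: neg_divide_le_eq pos_divide_le_eq)
      qed
      then have "(H v - a) / \<phi> v \<le> c" by (rule ge)
      then show ?thesis using 3 by (simp add: neg_divide_le_eq)
    qed
  qed
  moreover have "\<bar>c\<bar> \<le> lam"
    using ge[OF lower] le[of lam] by (simp add: Q_def abs_le_iff)
  ultimately show ?thesis by blast
qed

text \<open>The induction leaves \<open>H\<close> arbitrary because \<open>H\<close> serves as a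
  store: the remaining penalties are absorbed into it while one slope is found, and the resulting
  linear term is absorbed into it for the induction hypothesis. Both operations preserve
  convexity.\<close>

lemma abs_penalty_slopes:
  fixes \<phi> :: "'i \<Rightarrow> 'a::real_vector \<Rightarrow> real"
  assumes "finite I" and "convex_on V H" and "\<And>i. i \<in> I \<Longrightarrow> linear (\<phi> i)" and "lam \<ge> 0"
    and "\<And>v. v \<in> V \<Longrightarrow> a \<le> H v + lam * (\<Sum>i\<in>I. \<bar>\<phi> i v\<bar>)"
  shows "\<exists>c. (\<forall>i\<in>I. \<bar>c i\<bar> \<le> lam) \<and> (\<forall>v\<in>V. a \<le> H v - (\<Sum>i\<in>I. c i * \<phi> i v))"
  using assms
proof (induction I arbitrary: H rule: finite_induct)
  case empty
  then show ?case by simp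
next
  case (insert i I)
  have conv: "convex_on V (\<lambda>v. H v + lam * (\<Sum>i\<in>J. \<bar>\<phi> i v\<bar>))" if "finite J" "J \<subseteq> I" for J
    using that
  proof (induction J rule: finite_induct)
    case empty
    then show ?case using insert.prems by simp
  next
    case (insert j J)
    have "convex_on V (\<lambda>v. (H v + lam * (\<Sum>i\<in>J. \<bar>\<phi> i v\<bar>)) + lam * \<bar>\<phi> j v\<bar>)"
      using insert \<open>\<And>k. k \<in> Set.insert i I \<Longrightarrow> linear (\<phi> k)\<close> \<open>lam \<ge> 0\<close>
      by (intro convex_on_plus_abs_linear) auto
    then show ?case using insert by (simp add: algebra_simps)
  qed
  obtain b where b: "\<bar>b\<bar> \<le> lam"
      "\<forall>v\<in>V. a \<le> (H v + lam * (\<Sum>i\<in>I. \<bar>\<phi> i v\<bar>)) - b * \<phi> i v"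
    using abs_penalty_slope[OF conv[OF insert.hyps(1) order_refl], of "\<phi> i" lam a]
      insert.prems insert.hyps by (auto simp: algebra_simps)
  obtain c where c: "\<forall>j\<in>I. \<bar>c j\<bar> \<le> lam"
      "\<forall>v\<in>V. a \<le> (H v - b * \<phi> i v) - (\<Sum>j\<in>I. c j * \<phi> j v)"
    using insert.IH[of "\<lambda>v. H v - b * \<phi> i v"] insert.prems b(2)
      convex_on_minus_linear[of V H "\<phi> i" b] by (auto simp: algebra_simps)
  have "(\<Sum>j\<in>I. (c(i := b)) j * \<phi> j v) = (\<Sum>j\<in>I. c j * \<phi> j v)" for v
    using insert.hyps by (intro sum.cong) auto
  then show ?case
    using b c insert.hyps by (intro exI[of _ "c(i := b)"]) (auto simp: algebra_simps)
qed

subsection \<open>Coordinate spaces\<close>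

lemma lookup_scaleR [simp]: "Poly_Mapping.lookup (r *\<^sub>R x) i = r *\<^sub>R Poly_Mapping.lookup x i"
proof -
  have "finite {i. r *\<^sub>R Poly_Mapping.lookup x i \<noteq> 0}"
    by (rule finite_subset[OF _ finite_lookup[of x]]) auto
  then show ?thesis
    by (simp add: scaleR_poly_mapping_def)
qed

lemma mem_Rn_iff: "x \<in> Rn m \<longleftrightarrow> (\<forall>i. i \<notin> {1..m} \<longrightarrow> Poly_Mapping.lookup x i = 0)"
  by (auto simp: Rn_def in_keys_iff)

lemma zero_in_Rn [simp]: "0 \<in> Rn m"
  by (simp add: mem_Rn_iff)

lemma Rn_add: "x \<in> Rn m \<Longrightarrow> y \<in> Rn m \<Longrightarrow> x + y \<in> Rn m"
  by (simp add: mem_Rn_iff lookup_add)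

lemma Rn_diff: "x \<in> Rn m \<Longrightarrow> y \<in> Rn m \<Longrightarrow> x - y \<in> Rn m"
  by (simp add: mem_Rn_iff lookup_minus)

lemma Rn_scaleR: "x \<in> Rn m \<Longrightarrow> r *\<^sub>R x \<in> Rn m"
  by (simp add: mem_Rn_iff)

lemma single_in_Rn: "i \<in> {1..m} \<Longrightarrow> Poly_Mapping.single i r \<in> Rn m"
  by (simp add: mem_Rn_iff lookup_single when_def)

lemma Rn_eqI:
  assumes "x \<in> Rn m" "y \<in> Rn m"
    and "\<And>i. i \<in> {1..m} \<Longrightarrow> Poly_Mapping.lookup x i = Poly_Mapping.lookup y i"
  shows "x = y"
  using assms by (intro poly_mapping_eqI) (metis mem_Rn_iff)

lemma norm_rvec: "norm (x::rvec) = (\<Sum>i\<in>Poly_Mapping.keys x. \<bar>Poly_Mapping.lookup x i\<bar>)"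
  by (simp add: norm_poly_mapping_def dist_poly_mapping_def)

text \<open>The norm carried by the type of finitely supported functions is already the l1 norm, so
  limits and continuity in the normed space can be used for the penalty directly.\<close>

lemma norm_one_eq_norm: "x \<in> Rn m \<Longrightarrow> norm_one m x = norm x"
  unfolding norm_one_def norm_rvec
  by (rule sum.mono_neutral_right) (auto simp: Rn_def in_keys_iff)

lemma abs_lookup_le_norm: "\<bar>Poly_Mapping.lookup x i\<bar> \<le> norm (x::rvec)"
proof (cases "i \<in> Poly_Mapping.keys x")
  case True
  then show ?thesis
    using member_le_sum[of i "Poly_Mapping.keys x" "\<lambda>i. \<bar>Poly_Mapping.lookup x i\<bar>"]
    by (simp add: norm_rvec)
qed (simp add: in_keys_iff)

lemma bounded_linear_lookup: "bounded_linear (\<lambda>x::rvec. Poly_Mapping.lookup x i)"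
  by (rule bounded_linear_intro[where K = 1]) (auto simp: lookup_add abs_lookup_le_norm)

lemma linear_lookup: "linear (\<lambda>x::rvec. Poly_Mapping.lookup x i)"
  using bounded_linear_lookup by (rule bounded_linear.linear)

lemma bounded_linear_dot: "bounded_linear (dot m y)"
  unfolding dot_def
  by (intro bounded_linear_sum bounded_linear_const_mult bounded_linear_lookup)

lemma dot_zero [simp]: "dot m y 0 = 0"
  by (simp add: dot_def)

lemma norm_sup_le_iff:
  "m \<ge> 1 \<Longrightarrow> norm_sup m x \<le> r \<longleftrightarrow> (\<forall>i\<in>{1..m}. \<bar>Poly_Mapping.lookup x i\<bar> \<le> r)"
  unfolding norm_sup_def by (subst Max_le_iff) auto

lemma Rn_expand:
  assumes "x \<in> Rn m"
  shows "x = (\<Sum>i=1..m. Poly_Mapping.lookup x i *\<^sub>R Poly_Mapping.single i 1)"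
proof (rule Rn_eqI[OF assms])
  show "(\<Sum>i=1..m. Poly_Mapping.lookup x i *\<^sub>R Poly_Mapping.single i 1) \<in> Rn m"
    by (auto simp: mem_Rn_iff lookup_sum lookup_single when_def intro!: sum.neutral)
qed (simp add: lookup_sum lookup_single when_def if_distrib sum.delta cong: if_cong)

text \<open>Built as a finite sum of single-coordinate vectors, so that finiteness of the support is
  automatic.\<close>

definition rvec_of :: "nat \<Rightarrow> (nat \<Rightarrow> real) \<Rightarrow> rvec" where
  "rvec_of m c = (\<Sum>i=1..m. Poly_Mapping.single i (c i))"

lemma lookup_rvec_of: "Poly_Mapping.lookup (rvec_of m c) i = (if i \<in> {1..m} then c i else 0)"
  by (auto simp: rvec_of_def lookup_sum lookup_single when_def sum.delta)

lemma rvec_of_in_Rn [simp]: "rvec_of m c \<in> Rn m"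
  by (simp add: mem_Rn_iff lookup_rvec_of)

text \<open>Bolzano-Weierstrass for a finite-dimensional subspace of an infinite-dimensional space:
  one subsequence makes all \<open>m\<close> coordinates converge, and the distance to the limit is
  the finite sum of the coordinate distances.\<close>

lemma bounded_sequence_in_Rn_convergent_subsequence:
  assumes v: "\<And>k. v k \<in> Rn m" and B: "\<And>k. norm (v k) \<le> B"
  shows "\<exists>x r. x \<in> Rn m \<and> strict_mono (r::nat \<Rightarrow> nat) \<and> (v \<circ> r) \<longlonglongrightarrow> x"
proof -
  have "bounded (range (\<lambda>k. Poly_Mapping.lookup (v k) i))" for i
    using order_trans[OF abs_lookup_le_norm B] by (auto intro!: boundedI[where B = B])
  \<comment> \<open>The extraction is applied to the coordinate functions themselves, hence both
    projection maps are the identity.\<close>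
  then have "\<forall>\<delta>\<subseteq>{1..m}. \<exists>l::nat \<Rightarrow> real. \<exists>r::nat\<Rightarrow>nat. strict_mono r \<and>
      (\<forall>\<epsilon>>0. \<forall>\<^sub>F k in sequentially. \<forall>i\<in>\<delta>. dist (Poly_Mapping.lookup (v (r k)) i) (l i) < \<epsilon>)"
    by (intro compact_lemma_general[where proj = "\<lambda>x. x" and unproj = "\<lambda>x. x"]) 
       (auto simp: image_image)
  then obtain l r where r: "strict_mono (r::nat\<Rightarrow>nat)" and
    l: "\<And>\<epsilon>. \<epsilon> > 0 \<Longrightarrow> \<forall>\<^sub>F k in sequentially.
          \<forall>i\<in>{1..m}. dist (Poly_Mapping.lookup (v (r k)) i) (l i :: real) < \<epsilon>"
    by blast
  have "(\<lambda>k. Poly_Mapping.lookup (v (r k)) i) \<longlonglongrightarrow> l i" if "i \<in> {1..m}" for i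
    unfolding tendsto_iff
  proof (intro allI impI)
    fix e :: real assume "e > 0"
    from l[OF this] show "\<forall>\<^sub>F k in sequentially. dist (Poly_Mapping.lookup (v (r k)) i) (l i) < e"
      by eventually_elim (use that in blast)
  qed
  then have "(\<lambda>k. \<Sum>i=1..m. \<bar>Poly_Mapping.lookup (v (r k)) i - l i\<bar>) \<longlonglongrightarrow> (\<Sum>i=1..m. \<bar>l i - l i\<bar>)"
    by (intro tendsto_intros)
  moreover have "norm (v (r k) - rvec_of m l) = (\<Sum>i=1..m. \<bar>Poly_Mapping.lookup (v (r k)) i - l i\<bar>)" for k
    using norm_one_eq_norm[OF Rn_diff[OF v rvec_of_in_Rn], of "r k" l]
    by (simp add: norm_one_def lookup_minus lookup_rvec_of)
  ultimately have "(\<lambda>k. norm (v (r k) - rvec_of m l)) \<longlonglongrightarrow> 0" by simp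
  then have "(v \<circ> r) \<longlonglongrightarrow> rvec_of m l"
    unfolding o_def by (rule LIM_zero_cancel[OF tendsto_norm_zero_cancel])
  then show ?thesis using r rvec_of_in_Rn by blast
qed

subsection \<open>Subgradients and minimizers\<close>

text \<open>Moves the base point \<open>x\<close> to the origin, where the coordinate penalties are
  centred.\<close>

lemma convex_on_translate_Rn:
  assumes "convex_on (Rn m) f" "x \<in> Rn m"
  shows "convex_on (Rn m) (\<lambda>v. f (v + x))"
  unfolding convex_on_def
proof (intro conjI ballI allI impI)
  show "convex (Rn m)" using assms(1) by (simp add: convex_on_def)
  fix v w and s t :: real
  assume h: "v \<in> Rn m" "w \<in> Rn m" "s \<ge> 0" "t \<ge> 0" "s + t = 1"
  have "s *\<^sub>R v + t *\<^sub>R w + x = s *\<^sub>R (v + x) + t *\<^sub>R (w + x)"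
    using h(5) scaleR_add_left[of s t x] by (simp add: algebra_simps)
  then show "f (s *\<^sub>R v + t *\<^sub>R w + x) \<le> s * f (v + x) + t * f (w + x)"
    using assms h Rn_add by (simp add: convex_on_def)
qed

text \<open>With the coordinate maps as linear functionals and the value \<open>f x\<close> as the
  lower bound, the slopes that replace the penalties are exactly the coordinates of a
  subgradient.\<close>

lemma subgradient_with_bound:
  assumes f: "convex_on (Rn m) f" and lam: "lam \<ge> 0" and x: "x \<in> Rn m"
    and bound: "\<And>v. v \<in> Rn m \<Longrightarrow> f x \<le> f (v + x) + lam * norm v"
  shows "\<exists>y\<in>subdifferential m f x. \<forall>i. \<bar>Poly_Mapping.lookup y i\<bar> \<le> lam"
proof -
  have "f x \<le> f (v + x) + lam * (\<Sum>i=1..m. \<bar>Poly_Mapping.lookup v i\<bar>)" if "v \<in> Rn m" for v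
    using bound[OF that] norm_one_eq_norm[OF that] by (simp add: norm_one_def)
  from abs_penalty_slopes[OF finite_atLeastAtMost convex_on_translate_Rn[OF f x]
      linear_lookup lam this]
  obtain c where c: "\<forall>i\<in>{1..m}. \<bar>c i\<bar> \<le> lam"
      "\<forall>v\<in>Rn m. f x \<le> f (v + x) - (\<Sum>i=1..m. c i * Poly_Mapping.lookup v i)"
    by blast
  have "f x + dot m (rvec_of m c) (v - x) \<le> f v" if "v \<in> Rn m" for v
    using c(2) Rn_diff[OF that x] by (force simp: dot_def lookup_rvec_of)
  then show ?thesis
    using c(1) lam by (intro bexI[of _ "rvec_of m c"]) (auto simp: subdifferential_def lookup_rvec_of)
qed

text \<open>
  On the unit sphere of the \<open>l\<^sup>1\<close> norm, \<open>f\<close> is at most its maximum \<open>M\<close> over the points \<open>\<plusminus>e\<^sub>i\<close>. As \<open>0\<close> lies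
  between \<open>v\<close> and \<open>- v / \<parallel>v\<parallel>\<close>, convexity bounds \<open>f v\<close> from below.
\<close>

lemma convex_on_Rn_linear_minorant:
  assumes f: "convex_on (Rn m) f"
  shows "\<exists>\<mu>\<ge>0. \<forall>v\<in>Rn m. f 0 \<le> f v + \<mu> * norm v"
proof -
  define e where "e i s = Poly_Mapping.single i (s::real)" for i :: nat and s
  \<comment> \<open>Including \<open>f 0\<close> makes the constant \<open>M - f 0\<close>
    nonnegative, and the set nonempty even for \<open>m = 0\<close>.\<close>
  define M where "M = Max (insert (f 0) ((\<lambda>i. f (e i 1)) ` {1..m} \<union> (\<lambda>i. f (e i (-1))) ` {1..m}))"
  have M: "f 0 \<le> M" "\<And>i. i \<in> {1..m} \<Longrightarrow> f (e i 1) \<le> M" "\<And>i. i \<in> {1..m} \<Longrightarrow> f (e i (-1)) \<le> M"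
    unfolding M_def by (intro Max_ge; force)+
  have "f 0 \<le> f v + (M - f 0) * norm v" if v: "v \<in> Rn m" for v
  proof (cases "v = 0")
    case False
    define s where "s = norm v"
    have s: "s > 0" using False by (simp add: s_def)
    have s_sum: "s = (\<Sum>i=1..m. \<bar>Poly_Mapping.lookup v i\<bar>)"
      using norm_one_eq_norm[OF v] by (simp add: s_def norm_one_def)
    define w where "w = (- 1 / s) *\<^sub>R v"
    \<comment> \<open>The unit vector pointing against the sign of the i-th coordinate of
      \<open>v\<close>. Where that coordinate is zero its weight below is zero, so either sign would
      do.\<close>
    define g where "g i = (if Poly_Mapping.lookup v i > 0 then e i (-1) else e i 1)" for i
    have w: "w \<in> Rn m" unfolding w_def using v by (rule Rn_scaleR)
    have "w = (\<Sum>i=1..m. (\<bar>Poly_Mapping.lookup v i\<bar> / s) *\<^sub>R g i)"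
    proof (rule Rn_eqI[OF w])
      show "(\<Sum>i=1..m. (\<bar>Poly_Mapping.lookup v i\<bar> / s) *\<^sub>R g i) \<in> Rn m"
        by (auto simp: mem_Rn_iff lookup_sum lookup_single when_def g_def e_def intro!: sum.neutral)
      fix i assume i: "i \<in> {1..m}"
      have "(\<Sum>j=1..m. (\<bar>Poly_Mapping.lookup v j\<bar> / s) * Poly_Mapping.lookup (g j) i)
          = (\<Sum>j=1..m. if j = i then - Poly_Mapping.lookup v i / s else 0)"
        by (rule sum.cong) (auto simp: g_def e_def lookup_single when_def)
      then show "Poly_Mapping.lookup w i
          = Poly_Mapping.lookup (\<Sum>i=1..m. (\<bar>Poly_Mapping.lookup v i\<bar> / s) *\<^sub>R g i) i"
        using i by (simp add: lookup_sum w_def)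
    qed
    moreover have "f (\<Sum>i=1..m. (\<bar>Poly_Mapping.lookup v i\<bar> / s) *\<^sub>R g i)
        \<le> (\<Sum>i=1..m. (\<bar>Poly_Mapping.lookup v i\<bar> / s) * f (g i))"
    proof (rule convex_on_sum[OF _ _ f])
      show "{1..m} \<noteq> {}" using s s_sum by (metis sum.empty less_irrefl)
      show "(\<Sum>i=1..m. \<bar>Poly_Mapping.lookup v i\<bar> / s) = 1"
        using s s_sum by (simp flip: sum_divide_distrib)
    qed (use s in \<open>auto simp: g_def e_def single_in_Rn\<close>)
    moreover have "(\<Sum>i=1..m. (\<bar>Poly_Mapping.lookup v i\<bar> / s) * f (g i))
        \<le> (\<Sum>i=1..m. (\<bar>Poly_Mapping.lookup v i\<bar> / s) * M)"
      using s M by (intro sum_mono mult_left_mono) (auto simp: g_def)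
    moreover have "\<dots> = M"
      using s s_sum by (simp flip: sum_divide_distrib sum_distrib_right)
    ultimately have fw: "f w \<le> M" by simp
    have "(1 / (1 + s)) *\<^sub>R v + (s / (1 + s)) *\<^sub>R w = 0"
      using s by (simp add: w_def)
    moreover have "f ((1 / (1 + s)) *\<^sub>R v + (s / (1 + s)) *\<^sub>R w)
        \<le> (1 / (1 + s)) * f v + (s / (1 + s)) * f w"
    proof -
      have "1 / (1 + s) + s / (1 + s) = 1" "0 \<le> 1 / (1 + s)" "0 \<le> s / (1 + s)"
        using s by (auto simp: field_simps)
      then show ?thesis using f v w unfolding convex_on_def by blast
    qed
    ultimately have "f 0 \<le> (f v + s * f w) / (1 + s)"
      by (simp add: add_divide_distrib)
    then have "f 0 * (1 + s) \<le> f v + s * f w"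
      using s by (simp add: pos_le_divide_eq)
    also have "\<dots> \<le> f v + s * M" using fw s by simp
    finally show ?thesis by (simp add: s_def algebra_simps)
  qed simp
  then show ?thesis using M(1) by (intro exI[of _ "M - f 0"]) auto
qed

text \<open>The minorant of slope \<open>\<mu>\<close>, translated to \<open>x\<close>, says that
  \<open>x\<close> minimizes \<open>f\<close> plus \<open>\<mu>\<close> times the distance to
  \<open>x\<close>; this already produces a subgradient.\<close>

lemma subdifferential_nonempty:
  assumes f: "convex_on (Rn m) f" and x: "x \<in> Rn m"
  shows "subdifferential m f x \<noteq> {}"
proof -
  obtain \<mu> where "\<mu> \<ge> 0" "\<And>v. v \<in> Rn m \<Longrightarrow> f x \<le> f (v + x) + \<mu> * norm v"
    using convex_on_Rn_linear_minorant[OF convex_on_translate_Rn[OF f x]] by auto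
  then show ?thesis
    using subgradient_with_bound[OF f _ x] by blast
qed

text \<open>Direct method: the lower bound on \<open>f\<close> makes the penalty coercive, so a
  minimizing sequence is bounded and has a limit point \<open>x\<close>. A subgradient at
  \<open>x\<close> then controls the values of \<open>f\<close> along the subsequence from
  below.\<close>

lemma l1_penalty_minimizer_exists:
  assumes f: "convex_on (Rn m) f" and below: "\<And>v. v \<in> Rn m \<Longrightarrow> B \<le> f v" and lam: "lam > 0"
  shows "\<exists>x\<in>Rn m. \<forall>v\<in>Rn m. f x + lam * norm x \<le> f v + lam * norm v"
proof -
  define F where "F v = f v + lam * norm v" for v
  define a where "a = Inf (F ` Rn m)"
  have bdd: "bdd_below (F ` Rn m)"
    using below lam by (intro bdd_belowI2[where m = B]) (simp add: F_def add_increasing2)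
  have a: "a \<le> F v" if "v \<in> Rn m" for v
    unfolding a_def using that bdd by (simp add: cInf_lower)
  have "\<exists>v\<in>Rn m. F v < a + 1 / real (Suc k)" for k
  proof -
    have "F ` Rn m \<noteq> {}" using zero_in_Rn by blast
    then show ?thesis
      using cInf_lessD[of "F ` Rn m" "a + 1 / real (Suc k)"] by (auto simp: a_def)
  qed
  then obtain v where v: "\<And>k. v k \<in> Rn m" "\<And>k. F (v k) < a + 1 / real (Suc k)"
    by metis
  have "norm (v k) \<le> (a + 1 - B) / lam" for k
  proof -
    have "1 / real (Suc k) \<le> 1" by simp
    then have "F (v k) \<le> a + 1" using v(2)[of k] by linarith
    then have "lam * norm (v k) \<le> a + 1 - B" using below[OF v(1), of k] by (simp add: F_def)
    then show ?thesis using lam by (simp add: pos_le_divide_eq mult.commute)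
  qed
  then obtain x r where x: "x \<in> Rn m" "strict_mono (r::nat \<Rightarrow> nat)" "(v \<circ> r) \<longlonglongrightarrow> x"
    using bounded_sequence_in_Rn_convergent_subsequence[of v m] v(1) by metis
  obtain y where y: "y \<in> subdifferential m f x"
    using subdifferential_nonempty[OF f x(1)] by blast
  have x': "(\<lambda>k. v (r k)) \<longlonglongrightarrow> x" using x(3) by (simp add: o_def)
  \<comment> \<open>The affine minorant is continuous and agrees with \<open>f\<close> at
    \<open>x\<close>, so the limit can be taken in it instead of in \<open>f\<close>.\<close>
  have "(\<lambda>k. f x + dot m y (v (r k) - x) + lam * norm (v (r k))) \<longlonglongrightarrow>
      f x + dot m y (x - x) + lam * norm x"
    by (intro tendsto_intros bounded_linear.tendsto[OF bounded_linear_dot] x')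
  moreover have "(\<lambda>k. a + 1 / real (Suc (r k))) \<longlonglongrightarrow> a + 0"
    using LIMSEQ_subseq_LIMSEQ[OF LIMSEQ_Suc[OF lim_1_over_n] x(2)]
    by (intro tendsto_intros) (simp add: o_def)
  moreover have "f x + dot m y (v (r k) - x) + lam * norm (v (r k)) \<le> a + 1 / real (Suc (r k))" for k
  proof -
    have "f x + dot m y (v (r k) - x) \<le> f (v (r k))"
      using y v(1)[of "r k"] by (simp add: subdifferential_def)
    then show ?thesis using v(2)[of "r k"] by (simp add: F_def)
  qed
  ultimately have "f x + dot m y (x - x) + lam * norm x \<le> a + 0"
    by (intro LIMSEQ_le) auto
  then have "F x \<le> a" by (simp add: F_def)
  then show ?thesis using a x(1) by (force simp: F_def)
qed

text \<open>One direction is the bounded subgradient constructed above at \<open>x = 0\<close>; the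
  other is the Hoelder inequality between the sup norm and the l1 norm.\<close>

lemma zero_minimizes_iff_subgradient:
  assumes f: "convex_on (Rn m) f" and lam: "lam \<ge> 0" and m: "m \<ge> 1"
  shows "(\<forall>v\<in>Rn m. f 0 \<le> f v + lam * norm v) \<longleftrightarrow> (\<exists>y\<in>subdifferential m f 0. norm_sup m y \<le> lam)"
proof
  assume "\<forall>v\<in>Rn m. f 0 \<le> f v + lam * norm v"
  then show "\<exists>y\<in>subdifferential m f 0. norm_sup m y \<le> lam"
    using subgradient_with_bound[OF f lam zero_in_Rn] m by (auto simp: norm_sup_le_iff)
next
  assume "\<exists>y\<in>subdifferential m f 0. norm_sup m y \<le> lam"
  then obtain y where y: "y \<in> subdifferential m f 0" "norm_sup m y \<le> lam" by blast
  show "\<forall>v\<in>Rn m. f 0 \<le> f v + lam * norm v"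
  proof
    fix v assume v: "v \<in> Rn m"
    have "- dot m y v \<le> (\<Sum>i=1..m. lam * \<bar>Poly_Mapping.lookup v i\<bar>)"
      unfolding dot_def sum_negf[symmetric]
    proof (rule sum_mono)
      fix i assume "i \<in> {1..m}"
      then have "\<bar>Poly_Mapping.lookup y i\<bar> \<le> lam" using y(2) m by (simp add: norm_sup_le_iff)
      then have "\<bar>Poly_Mapping.lookup y i * Poly_Mapping.lookup v i\<bar> \<le> lam * \<bar>Poly_Mapping.lookup v i\<bar>"
        by (simp add: abs_mult mult_right_mono)
      then show "- (Poly_Mapping.lookup y i * Poly_Mapping.lookup v i) \<le> lam * \<bar>Poly_Mapping.lookup v i\<bar>"
        by linarith
    qed
    also have "\<dots> = lam * norm v"
      using norm_one_eq_norm[OF v] by (simp add: norm_one_def flip: sum_distrib_left)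
    finally show "f 0 \<le> f v + lam * norm v"
      using y(1) v by (force simp: subdifferential_def)
  qed
qed

section \<open>The least sup norm of a subgradient at the origin\<close>

lemma norm_sup_nonneg:
  assumes "m \<ge> 1"
  shows "0 \<le> norm_sup m y"
proof -
  have "\<bar>Poly_Mapping.lookup y 1\<bar> \<le> norm_sup m y"
    using norm_sup_le_iff[OF assms, of y "norm_sup m y"] assms by auto
  then show ?thesis by linarith
qed

text \<open>
  The infimum of the norms of the subgradients is itself an admissible weight of the penalty,
  hence attained; no compactness of the subdifferential is needed.
\<close>

lemma least_subgradient_norm:
  assumes f: "convex_on (Rn m) f" and m: "m \<ge> 1"
  shows "\<exists>y\<in>subdifferential m f 0. \<forall>z\<in>subdifferential m f 0. norm_sup m y \<le> norm_sup m z"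
proof -
  define N where "N = norm_sup m ` subdifferential m f 0"
  have ne: "N \<noteq> {}" using subdifferential_nonempty[OF f zero_in_Rn] by (simp add: N_def)
  have bdd: "bdd_below N"
    by (auto intro!: bdd_belowI[where m = 0] simp: N_def norm_sup_nonneg[OF m])
  have nonneg: "0 \<le> Inf N"
    using ne by (intro cInf_greatest) (auto simp: N_def norm_sup_nonneg[OF m])
  have "f 0 \<le> f v + Inf N * norm v" if v: "v \<in> Rn m" for v
  proof (rule field_le_epsilon)
    fix e :: real assume e: "e > 0"
    \<comment> \<open>Scaled so that the excess \<open>\<delta> * norm v\<close> stays below
      \<open>e\<close>; the added \<open>1\<close> covers \<open>v = 0\<close>.\<close>
    define \<delta> where "\<delta> = e / (norm v + 1)"
    have pos: "norm v + 1 > 0" using norm_ge_zero[of v] by linarith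
    then have \<delta>: "\<delta> > 0" "\<delta> * norm v \<le> e"
      using e by (simp_all add: \<delta>_def pos_divide_le_eq)
    obtain r where r: "r \<in> N" "r < Inf N + \<delta>"
      using cInf_lessD[OF ne, of "Inf N + \<delta>"] \<delta> by auto
    then have "f 0 \<le> f v + r * norm v"
      using zero_minimizes_iff_subgradient[OF f _ m, of r] v norm_sup_nonneg[OF m]
      by (auto simp: N_def)
    also have "\<dots> \<le> f v + (Inf N + \<delta>) * norm v"
      using r by (simp add: mult_right_mono)
    also have "\<dots> \<le> f v + Inf N * norm v + e"
      using \<delta> by (simp add: algebra_simps)
    finally show "f 0 \<le> f v + Inf N * norm v + e" .
  qed
  then obtain y where "y \<in> subdifferential m f 0" "norm_sup m y \<le> Inf N"
    using zero_minimizes_iff_subgradient[OF f nonneg m] by blast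
  then show ?thesis
    using cInf_lower[OF _ bdd] by (intro bexI[of _ y]) (auto simp: N_def intro: order_trans)
qed

text \<open>Since the minimal norm is attained, \<open>LEAST\<close> denotes a genuine minimum, and
  some subgradient has norm at most \<open>lam\<close> exactly when the one of least norm
  does.\<close>

lemma zero_minimizes_iff_Least:
  assumes f: "convex_on (Rn m) f" and lam: "lam \<ge> 0" and m: "m \<ge> 1"
  shows "(\<forall>v\<in>Rn m. f 0 \<le> f v + lam * norm v) \<longleftrightarrow>
    (LEAST r. r \<in> norm_sup m ` subdifferential m f 0) \<le> lam"
proof -
  obtain y where y: "y \<in> subdifferential m f 0"
      "\<forall>z\<in>subdifferential m f 0. norm_sup m y \<le> norm_sup m z"
    using least_subgradient_norm[OF f m] by blast
  then have "(LEAST r. r \<in> norm_sup m ` subdifferential m f 0) = norm_sup m y"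
    by (intro Least_equality) auto
  then show ?thesis
    using zero_minimizes_iff_subgradient[OF f lam m] y by (auto intro: order_trans)
qed

subsection \<open>The differentiable case\<close>

text \<open>The coordinate line through \<open>0\<close> stays in \<open>Rn m\<close>, so the chain
  rule turns the derivative within the subspace into an ordinary real derivative, for which
  uniqueness and the local minimum criterion are available.\<close>

lemma has_derivative_Rn_partial:
  assumes D: "(f has_derivative D) (at 0 within Rn m)" and i: "i \<in> {1..m}"
  shows "((\<lambda>t. f (t *\<^sub>R Poly_Mapping.single i 1)) has_real_derivative
    D (Poly_Mapping.single i 1)) (at 0)"
proof -
  define e :: rvec where "e = Poly_Mapping.single i 1"
  have e: "t *\<^sub>R e \<in> Rn m" for t
    unfolding e_def by (intro Rn_scaleR single_in_Rn i)
  have lin: "((\<lambda>t. t *\<^sub>R e) has_derivative (\<lambda>t. t *\<^sub>R e)) (at (0::real))"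
    by (intro derivative_eq_intros) auto
  have "(f has_derivative D) (at (0 *\<^sub>R e) within range (\<lambda>t. t *\<^sub>R e))"
    using D e by (auto intro: has_derivative_subset)
  from diff_chain_within[OF lin this]
  have "((\<lambda>t. f (t *\<^sub>R e)) has_derivative (\<lambda>t. D (t *\<^sub>R e))) (at 0)"
    by (simp add: o_def)
  moreover have "D (t *\<^sub>R e) = D e * t" for t
    using has_derivative_linear[OF D] by (simp add: linear_cmul)
  ultimately show ?thesis
    by (simp add: has_field_derivative_def e_def)
qed

lemma dot_single: "i \<in> {1..m} \<Longrightarrow> dot m y (Poly_Mapping.single i 1) = Poly_Mapping.lookup y i"
  by (simp add: dot_def lookup_single when_def if_distrib cong: if_cong)

text \<open>The partial derivatives determine every coordinate. This makes the description in
  \<open>gradient\<close> well defined at \<open>0\<close>.\<close>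

lemma has_derivative_dot_unique:
  assumes "(f has_derivative dot m g) (at 0 within Rn m)" "g \<in> Rn m"
    and "(f has_derivative dot m h) (at 0 within Rn m)" "h \<in> Rn m"
  shows "g = h"
proof (rule Rn_eqI)
  fix i assume i: "i \<in> {1..m}"
  show "Poly_Mapping.lookup g i = Poly_Mapping.lookup h i"
    using DERIV_unique[OF has_derivative_Rn_partial[OF assms(1) i]
        has_derivative_Rn_partial[OF assms(3) i]] i
    by (simp add: dot_single)
qed (use assms in auto)

lemma gradient_eqI:
  assumes "(f has_derivative dot m g) (at 0 within Rn m)" "g \<in> Rn m"
  shows "gradient m f 0 = g"
  unfolding gradient_def using assms has_derivative_dot_unique by (intro the_equality) auto

lemma differentiable_on_Rn_obtain_gradient:
  assumes "f differentiable_on Rn m"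
  obtains g where "g \<in> Rn m" "(f has_derivative dot m g) (at 0 within Rn m)"
proof -
  obtain D where D: "(f has_derivative D) (at 0 within Rn m)"
    using assms zero_in_Rn unfolding differentiable_on_def differentiable_def by blast
  define g where "g = rvec_of m (\<lambda>i. D (Poly_Mapping.single i 1))"
  have Dg: "D v = dot m g v" if "v \<in> Rn m" for v
  proof -
    have "D v = D (\<Sum>i=1..m. Poly_Mapping.lookup v i *\<^sub>R Poly_Mapping.single i 1)"
      using Rn_expand[OF that] by simp
    also have "\<dots> = dot m g v"
      using has_derivative_linear[OF D]
      by (simp add: linear_sum linear_cmul dot_def g_def lookup_rvec_of mult.commute)
    finally show ?thesis .
  qed
  \<comment> \<open>\<open>D\<close> and \<open>dot m g\<close> may differ off \<open>Rn m\<close>,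
    but the difference quotients at \<open>0\<close> evaluate them only on
    \<open>Rn m\<close>.\<close>
  have "(f has_derivative dot m g) (at 0 within Rn m)"
    using D Dg bounded_linear_dot unfolding has_derivative_within'
    by simp
  then show ?thesis using that[of g] by (simp add: g_def)
qed

text \<open>Along each coordinate line, \<open>f\<close> minus the linear part given by a
  subgradient is minimal at \<open>0\<close>, so its derivative vanishes there and the subgradient
  has the coordinates of the gradient. Nonemptiness then makes the inclusion an equality.\<close>

lemma subdifferential_differentiable:
  assumes f: "convex_on (Rn m) f" and diff: "f differentiable_on Rn m"
  shows "subdifferential m f 0 = {gradient m f 0}"
proof -
  obtain g where g: "g \<in> Rn m" "(f has_derivative dot m g) (at 0 within Rn m)"
    using differentiable_on_Rn_obtain_gradient[OF diff] .
  have "y = g" if y: "y \<in> subdifferential m f 0" for y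
  proof (rule Rn_eqI)
    show "y \<in> Rn m" using y by (simp add: subdifferential_def)
    fix i assume i: "i \<in> {1..m}"
    define e :: rvec where "e = Poly_Mapping.single i 1"
    have e: "t *\<^sub>R e \<in> Rn m" for t
      unfolding e_def by (intro Rn_scaleR single_in_Rn i)
    have dot_e: "dot m y (t *\<^sub>R e) = Poly_Mapping.lookup y i * t" for t
      using bounded_linear.linear[OF bounded_linear_dot, of m y] dot_single[OF i]
      by (simp add: linear_cmul e_def)
    have "((\<lambda>t. f (t *\<^sub>R e) - Poly_Mapping.lookup y i * t) has_real_derivative
        Poly_Mapping.lookup g i - Poly_Mapping.lookup y i) (at 0)"
      using has_derivative_Rn_partial[OF g(2) i] dot_single[OF i, of g]
      by (auto intro!: derivative_eq_intros simp: e_def)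
    moreover have "\<forall>t. \<bar>0 - t\<bar> < 1 \<longrightarrow>
        f (0 *\<^sub>R e) - Poly_Mapping.lookup y i * 0 \<le> f (t *\<^sub>R e) - Poly_Mapping.lookup y i * t"
    proof (intro allI impI)
      fix t
      have "f 0 + dot m y (t *\<^sub>R e - 0) \<le> f (t *\<^sub>R e)"
        using y e unfolding subdifferential_def by blast
      then show "f (0 *\<^sub>R e) - Poly_Mapping.lookup y i * 0 \<le> f (t *\<^sub>R e) - Poly_Mapping.lookup y i * t"
        by (simp add: dot_e)
    qed
    ultimately have "Poly_Mapping.lookup g i - Poly_Mapping.lookup y i = 0"
      by (rule DERIV_local_min[OF _ zero_less_one])
    then show "Poly_Mapping.lookup y i = Poly_Mapping.lookup g i" by simp
  qed (rule g)
  then show ?thesis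
    using subdifferential_nonempty[OF f zero_in_Rn] gradient_eqI[OF g(2,1)] by blast
qed

subsection \<open>Block decomposition\<close>

lemma bij_betw_sorted_list_of_set:
  assumes "finite A"
  shows "bij_betw (\<lambda>i. sorted_list_of_set A ! (i - 1)) {1..card A} A"
proof -
  have "bij_betw (\<lambda>i. i - 1) {1..card A} {..<card A}"
    by (rule bij_betw_byWitness[where f' = Suc]) auto
  moreover have "bij_betw ((!) (sorted_list_of_set A)) {..<card A} A"
    using assms by (intro bij_betw_nth) auto
  ultimately show ?thesis
    using bij_betw_trans by (fastforce simp: o_def)
qed

lemma norm_subvec:
  assumes "finite A"
  shows "norm (subvec A u) = (\<Sum>k\<in>A. \<bar>Poly_Mapping.lookup u k\<bar>)"
proof -
  have "norm (subvec A u) = (\<Sum>i\<in>{1..card A}. \<bar>Poly_Mapping.lookup u (sorted_list_of_set A ! (i - 1))\<bar>)"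
    using norm_one_eq_norm[OF subvec_in_Rn, of A u] by (simp add: norm_one_def lookup_subvec)
  also have "\<dots> = (\<Sum>k\<in>A. \<bar>Poly_Mapping.lookup u k\<bar>)"
    by (rule sum.reindex_bij_betw[OF bij_betw_sorted_list_of_set[OF assms]])
  finally show ?thesis .
qed

context
  fixes n d :: nat and S :: "nat \<Rightarrow> nat set"
  assumes partition: "partition_on {1..n} (S ` {1..d})" "inj_on S {1..d}"
begin

lemma block_subset: "j \<in> {1..d} \<Longrightarrow> S j \<subseteq> {1..n}"
  using partition(1) by (auto simp: partition_on_def)

lemma finite_block: "j \<in> {1..d} \<Longrightarrow> finite (S j)"
  using block_subset finite_subset by blast

lemma card_block: "j \<in> {1..d} \<Longrightarrow> card (S j) \<ge> 1"
  using partition(1) finite_block by (auto simp: partition_on_def Suc_le_eq card_gt_0_iff)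

text \<open>Disjointness separates blocks only as sets; injectivity of \<open>S\<close> carries this
  over to the indices.\<close>

lemma block_index_unique:
  assumes "i \<in> {1..d}" "j \<in> {1..d}" "k \<in> S i" "k \<in> S j"
  shows "i = j"
proof -
  have "disjoint (S ` {1..d})" using partition(1) by (simp add: partition_on_def)
  then have "S i = S j" using assms by (meson disjointD disjoint_iff imageI)
  then show ?thesis using partition(2) assms(1,2) by (simp add: inj_on_eq_iff)
qed

lemma norm_eq_sum_blocks:
  assumes "u \<in> Rn n"
  shows "norm u = (\<Sum>j=1..d. norm (subvec (S j) u))"
proof -
  have "norm u = (\<Sum>k\<in>\<Union>(S ` {1..d}). \<bar>Poly_Mapping.lookup u k\<bar>)"
    using norm_one_eq_norm[OF assms] partition(1) by (simp add: norm_one_def partition_on_def)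
  also have "\<dots> = (\<Sum>j=1..d. \<Sum>k\<in>S j. \<bar>Poly_Mapping.lookup u k\<bar>)"
  proof (rule sum.UNION_disjoint)
    show "\<forall>i\<in>{1..d}. finite (S i)" using finite_block by simp
    show "\<forall>i\<in>{1..d}. \<forall>j\<in>{1..d}. i \<noteq> j \<longrightarrow> S i \<inter> S j = {}"
      using block_index_unique by blast
  qed simp
  also have "\<dots> = (\<Sum>j=1..d. norm (subvec (S j) u))"
    using finite_block by (intro sum.cong) (auto simp: norm_subvec)
  finally show ?thesis .
qed

text \<open>Coordinate \<open>k\<close> of \<open>u\<close> is read off from the block
  \<open>idx k\<close> that contains \<open>k\<close>, at the position \<open>pos (idx k) k\<close>
  of \<open>k\<close> in the increasing enumeration of that block.\<close>

lemma blocks_assemble: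
  assumes w: "\<And>j. j \<in> {1..d} \<Longrightarrow> w j \<in> Rn (card (S j))"
  shows "\<exists>u\<in>Rn n. \<forall>j\<in>{1..d}. subvec (S j) u = w j"
proof -
  define pos where "pos j k = inv_into {1..card (S j)} (\<lambda>i. sorted_list_of_set (S j) ! (i - 1)) k" for j k
  define idx where "idx k = (THE j. j \<in> {1..d} \<and> k \<in> S j)" for k
  define u where "u = rvec_of n (\<lambda>k. Poly_Mapping.lookup (w (idx k)) (pos (idx k) k))"
  have "subvec (S j) u = w j" if j: "j \<in> {1..d}" for j
  proof (rule Rn_eqI[OF subvec_in_Rn w[OF j]])
    fix i assume i: "i \<in> {1..card (S j)}"
    define k where "k = sorted_list_of_set (S j) ! (i - 1)"
    note bij = bij_betw_sorted_list_of_set[OF finite_block[OF j]]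
    have k: "k \<in> S j" using bij_betwE[OF bij] i by (simp add: k_def)
    then have "k \<in> {1..n}" using block_subset[OF j] by blast
    moreover have "idx k = j"
      unfolding idx_def
    proof (rule the_equality)
      show "j \<in> {1..d} \<and> k \<in> S j" using j k by simp
      show "i = j" if "i \<in> {1..d} \<and> k \<in> S i" for i
        using that block_index_unique[OF _ j _ k] by blast
    qed
    moreover have "pos j k = i"
      unfolding pos_def k_def using bij_betw_inv_into_left[OF bij i] .
    ultimately show "Poly_Mapping.lookup (subvec (S j) u) i = Poly_Mapping.lookup (w j) i"
      using i unfolding lookup_subvec u_def lookup_rvec_of k_def[symmetric] by simp
  qed
  then show ?thesis by (intro bexI[of _ u]) (auto simp: u_def)
qed

text \<open>Supplies competitors that differ from \<open>u\<close> in a single block, so that all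
  other terms of a separable sum cancel.\<close>

lemma block_replace:
  assumes "j \<in> {1..d}" "w \<in> Rn (card (S j))"
  shows "\<exists>v\<in>Rn n. subvec (S j) v = w \<and> (\<forall>i\<in>{1..d} - {j}. subvec (S i) v = subvec (S i) u)"
proof -
  define x where "x i = (if i = j then w else subvec (S i) u)" for i
  have "x i \<in> Rn (card (S i))" for i
    using assms(2) subvec_in_Rn by (simp add: x_def)
  then obtain v where v: "v \<in> Rn n" "\<forall>i\<in>{1..d}. subvec (S i) v = x i"
    using blocks_assemble[of x] by blast
  then have "subvec (S j) v = w" "\<forall>i\<in>{1..d} - {j}. subvec (S i) v = subvec (S i) u"
    using assms(1) by (simp_all add: x_def)
  then show ?thesis using v(1) by blast
qed

lemma minimizes_sum_iff_minimizes_blocks: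
  fixes F :: "nat \<Rightarrow> rvec \<Rightarrow> real"
  shows "(\<forall>v\<in>Rn n. (\<Sum>j=1..d. F j (subvec (S j) u)) \<le> (\<Sum>j=1..d. F j (subvec (S j) v))) \<longleftrightarrow>
    (\<forall>j\<in>{1..d}. \<forall>w\<in>Rn (card (S j)). F j (subvec (S j) u) \<le> F j w)" (is "?L \<longleftrightarrow> ?R")
proof
  assume L: ?L
  show ?R
  proof (intro ballI)
    fix j w assume j: "j \<in> {1..d}" and w: "w \<in> Rn (card (S j))"
    obtain v where v: "v \<in> Rn n" "subvec (S j) v = w"
        "\<forall>i\<in>{1..d} - {j}. subvec (S i) v = subvec (S i) u"
      using block_replace[OF j w] by blast
    have "(\<Sum>i=1..d. F i (subvec (S i) u)) \<le> (\<Sum>i=1..d. F i (subvec (S i) v))"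
      using L v(1) by blast
    then show "F j (subvec (S j) u) \<le> F j w"
      using j v by (simp add: sum.remove)
  qed
next
  assume ?R
  then show ?L by (intro ballI sum_mono) (auto simp: subvec_in_Rn)
qed

text \<open>Only the sum is known to be nonnegative. Freezing the other blocks at zero turns this
  into a constant lower bound for one term, as the existence of block minimizers requires.\<close>

lemma block_bounded_below:
  fixes F :: "nat \<Rightarrow> rvec \<Rightarrow> real"
  assumes nonneg: "\<And>u. u \<in> Rn n \<Longrightarrow> 0 \<le> (\<Sum>j=1..d. F j (subvec (S j) u))" and j: "j \<in> {1..d}"
  shows "\<exists>B. \<forall>w\<in>Rn (card (S j)). B \<le> F j w"
proof -
  have "- (\<Sum>i\<in>{1..d} - {j}. F i (subvec (S i) 0)) \<le> F j w" if w: "w \<in> Rn (card (S j))" for w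
  proof -
    obtain v where v: "v \<in> Rn n" "subvec (S j) v = w"
        "\<forall>i\<in>{1..d} - {j}. subvec (S i) v = subvec (S i) 0"
      using block_replace[OF j w] by blast
    then show ?thesis using nonneg[OF v(1)] j by (simp add: sum.remove)
  qed
  then show ?thesis by blast
qed

end

section \<open>The regularization problem, solved block by block\<close>

theorem theorem3p5:
  fixes n d l :: nat
    and S :: "nat \<Rightarrow> nat set"
    and \<psi>b :: "nat \<Rightarrow> rvec \<Rightarrow> real"
    and \<psi> :: "rvec \<Rightarrow> real"
    and lam :: real
  assumes partition: "partition_on {1..n} (S ` {1..d})" "inj_on S {1..d}"
    and convex: "\<And>j. j \<in> {1..d} \<Longrightarrow> convex_on (Rn (card (S j))) (\<psi>b j)"
    and nonneg: "\<And>u. u \<in> Rn n \<Longrightarrow> \<psi> u \<ge> 0"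
    and separable: "\<And>u. u \<in> Rn n \<Longrightarrow> \<psi> u = (\<Sum>j=1..d. \<psi>b j (subvec (S j) u))"
    and lam: "lam > 0"
    and l: "l \<le> d"
  shows
    "((\<exists>u l'. is_arg_min (\<lambda>u. \<psi> u + lam * norm_one n u) (\<lambda>u. u \<in> Rn n) u
         \<and> block_sparsity S d u = l' \<and> l' \<le> l)
     \<longleftrightarrow>
     (\<exists>k :: nat \<Rightarrow> nat. k ` {1..l} \<subseteq> {1..d} \<and> inj_on k {1..l} \<and>
        (\<forall>j \<in> {1..d} - k ` {1..l}.
           lam \<ge> (LEAST r. r \<in> norm_sup (card (S j)) ` subdifferential (card (S j)) (\<psi>b j) 0))))
     \<and>
     ((\<forall>j\<in>{1..d}. \<psi>b j differentiable_on Rn (card (S j))) \<longrightarrow>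
     (\<forall>k :: nat \<Rightarrow> nat. k ` {1..l} \<subseteq> {1..d} \<and> inj_on k {1..l} \<longrightarrow>
        ((\<forall>j \<in> {1..d} - k ` {1..l}.
            lam \<ge> (LEAST r. r \<in> norm_sup (card (S j)) ` subdifferential (card (S j)) (\<psi>b j) 0))
         \<longleftrightarrow>
         (\<forall>j \<in> {1..d} - k ` {1..l}.
            lam \<ge> norm_sup (card (S j)) (gradient (card (S j)) (\<psi>b j) 0)))))"
proof -
  define F where "F j w = \<psi>b j w + lam * norm w" for j w
  define mu where "mu j = (LEAST r. r \<in> norm_sup (card (S j)) ` subdifferential (card (S j)) (\<psi>b j) 0)" for j
  have objective: "\<psi> u + lam * norm_one n u = (\<Sum>j=1..d. F j (subvec (S j) u))" if "u \<in> Rn n" for u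
    using that separable norm_eq_sum_blocks[OF partition that]
    by (simp add: F_def norm_one_eq_norm sum.distrib sum_distrib_left)
  have min_iff: "is_arg_min (\<lambda>u. \<psi> u + lam * norm_one n u) (\<lambda>u. u \<in> Rn n) u \<longleftrightarrow>
      (\<forall>j\<in>{1..d}. \<forall>w\<in>Rn (card (S j)). F j (subvec (S j) u) \<le> F j w)" if "u \<in> Rn n" for u
    unfolding minimizes_sum_iff_minimizes_blocks[OF partition, symmetric]
    using that by (auto simp: is_arg_min_linorder objective)
  have zero_iff: "(\<forall>w\<in>Rn (card (S j)). F j 0 \<le> F j w) \<longleftrightarrow> mu j \<le> lam" if "j \<in> {1..d}" for j
    using zero_minimizes_iff_Least[OF convex[OF that] _ card_block[OF partition that], of lam] lam
    by (simp add: F_def mu_def)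
  have minimizer: "\<exists>x\<in>Rn (card (S j)). \<forall>w\<in>Rn (card (S j)). F j x \<le> F j w" if j: "j \<in> {1..d}" for j
  proof -
    obtain B where "\<forall>w\<in>Rn (card (S j)). B \<le> \<psi>b j w"
      using block_bounded_below[OF partition _ j, of \<psi>b] nonneg separable by auto
    then show ?thesis
      unfolding F_def using l1_penalty_minimizer_exists[OF convex[OF j] _ lam] by blast
  qed
  have equiv: "(\<exists>u l'. is_arg_min (\<lambda>u. \<psi> u + lam * norm_one n u) (\<lambda>u. u \<in> Rn n) u
         \<and> block_sparsity S d u = l' \<and> l' \<le> l) \<longleftrightarrow>
     (\<exists>k :: nat \<Rightarrow> nat. k ` {1..l} \<subseteq> {1..d} \<and> inj_on k {1..l} \<and>
        (\<forall>j \<in> {1..d} - k ` {1..l}. lam \<ge> mu j))" (is "?L \<longleftrightarrow> ?R")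
  proof
    assume ?L
    then obtain u where u: "is_arg_min (\<lambda>u. \<psi> u + lam * norm_one n u) (\<lambda>u. u \<in> Rn n) u"
        "block_sparsity S d u \<le> l"
      by blast
    have uRn: "u \<in> Rn n" using u(1) by (simp add: is_arg_min_def)
    have "{j \<in> {1..d}. subvec (S j) u \<noteq> 0} \<subseteq> {1..d}" by blast
    \<comment> \<open>There may be fewer than \<open>l\<close> nonzero blocks, whereas
      \<open>k\<close> must list exactly \<open>l\<close> distinct indices; \<open>l \<le> d\<close>
      leaves room to enlarge the set.\<close>
    then obtain K where K: "{j \<in> {1..d}. subvec (S j) u \<noteq> 0} \<subseteq> K" "K \<subseteq> {1..d}" "card K = l"
      using exists_subset_between[of "{j \<in> {1..d}. subvec (S j) u \<noteq> 0}" l "{1..d}"] u(2) l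
      unfolding block_sparsity_def by auto
    have "finite K" using K(2) finite_subset by blast
    then obtain k where k: "bij_betw k {1..l} K"
      using ex_bij_betw_nat_finite_1 K(3) by blast
    have "mu j \<le> lam" if "j \<in> {1..d} - K" for j
    proof -
      have "subvec (S j) u = 0" using that K(1) by blast
      then show ?thesis
        using u(1) min_iff[OF uRn] zero_iff[of j] that by (metis DiffD1)
    qed
    then show ?R
      using k K(2) by (intro exI[of _ k]) (auto simp: bij_betw_def)
  next
    assume ?R
    then obtain k :: "nat \<Rightarrow> nat" where k: "k ` {1..l} \<subseteq> {1..d}" "inj_on k {1..l}"
        "\<forall>j \<in> {1..d} - k ` {1..l}. mu j \<le> lam"
      by blast
    \<comment> \<open>On the chosen blocks any minimizer serves; on all others the bound on
      \<open>mu j\<close> allows the minimizer \<open>0\<close>.\<close>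
    have "\<exists>x. x \<in> Rn (card (S j)) \<and> (\<forall>w\<in>Rn (card (S j)). F j x \<le> F j w) \<and>
        (j \<notin> k ` {1..l} \<longrightarrow> x = 0)" if "j \<in> {1..d}" for j
      using minimizer[OF that] zero_iff[OF that] k(3) that zero_in_Rn
      by (cases "j \<in> k ` {1..l}") auto
    then obtain x where x: "\<And>j. j \<in> {1..d} \<Longrightarrow> x j \<in> Rn (card (S j))"
        "\<And>j. j \<in> {1..d} \<Longrightarrow> \<forall>w\<in>Rn (card (S j)). F j (x j) \<le> F j w"
        "\<And>j. j \<in> {1..d} \<Longrightarrow> j \<notin> k ` {1..l} \<Longrightarrow> x j = 0"
      by metis
    obtain u where u: "u \<in> Rn n" "\<forall>j\<in>{1..d}. subvec (S j) u = x j"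
      using blocks_assemble[OF partition, of x] x(1) by blast
    have "is_arg_min (\<lambda>u. \<psi> u + lam * norm_one n u) (\<lambda>u. u \<in> Rn n) u"
      using min_iff[OF u(1)] u(2) x(2) by simp
    \<comment> \<open>Only an inequality, since a minimizer picked on a chosen block may itself be
      zero.\<close>
    moreover have "block_sparsity S d u \<le> card (k ` {1..l})"
      unfolding block_sparsity_def
    proof (rule card_mono)
      show "{j \<in> {1..d}. subvec (S j) u \<noteq> 0} \<subseteq> k ` {1..l}"
      proof
        fix j assume "j \<in> {j \<in> {1..d}. subvec (S j) u \<noteq> 0}"
        then have "j \<in> {1..d}" "x j \<noteq> 0" using u(2) by auto
        then show "j \<in> k ` {1..l}" using x(3)[of j] by blast
      qed
    qed simp
    moreover have "card (k ` {1..l}) = l" using k(2) by (simp add: card_image)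
    ultimately show ?L by auto
  qed
  \<comment> \<open>The subdifferential is the singleton of the gradient, so the minimum runs over
    one value.\<close>
  have "mu j = norm_sup (card (S j)) (gradient (card (S j)) (\<psi>b j) 0)"
    if "j \<in> {1..d}" "\<psi>b j differentiable_on Rn (card (S j))" for j
    unfolding mu_def subdifferential_differentiable[OF convex[OF that(1)] that(2)]
    by (intro Least_equality) auto
  then have grad_iff: "(\<forall>j \<in> {1..d} - K. lam \<ge> mu j) \<longleftrightarrow>
      (\<forall>j \<in> {1..d} - K. lam \<ge> norm_sup (card (S j)) (gradient (card (S j)) (\<psi>b j) 0))"
    if "\<forall>j\<in>{1..d}. \<psi>b j differentiable_on Rn (card (S j))" for K
    using that by (intro ball_cong refl) simp
  show ?thesis
    unfolding mu_def[symmetric] using equiv grad_iff by (intro conjI impI allI)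
qed

end
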